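(* Let $r,\theta\in\mathbb{R}$, $\kappa>0$, $\xi>0$, $\rho\in[-1,1]$ and $h>0$. The Strang--Marchuk operator splitting scheme (defined in the context) advances the solution over one step of length $h$ from $(X_t,\sigma_t)$ to $(X_{t+h}^{\rm split},\sigma_{t+h}^{\rm split})$ as follows: $$X_{t+h}^{\rm split}=X_t+rh-\tfrac12 I_t^{{\rm split},h}+\frac{\rho}{2\xi}\bigl\{\widehat\sigma^2-\widetilde\sigma^2-\xi^2h\bigr\}+\sqrt{(1-\rho^2)\,I_t^{{\rm split},h}}\;Z_1,\qquad \sigma_{t+h}^{\rm split}=D(\widehat\sigma,h/2),$$ where $Z_1$ and $Z_2$ are independent standard normal variates, and $$\widetilde\sigma=D(\sigma_t,h/2),\qquad \widehat\sigma=\widetilde\sigma+\xi\sqrt h\,Z_2,\qquad I_t^{{\rm split},h}=Q(\sigma_t,h/2)+Q(\widehat\sigma,h/2).$$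
   Context: The model is the Ornstein--Uhlenbeck driven stochastic volatility model for the log asset price $X_t$ and volatility $\sigma_t$: $$dX_t=(r-\tfrac12\sigma_t^2)\,dt+\sqrt{1-\rho^2}\,\sigma_t\,dW_t^{(1)}+\rho\sigma_t\,dW_t^{(2)},\qquad d\sigma_t=\kappa(\theta-\sigma_t)\,dt+\xi\,dW_t^{(2)},$$ with $W^{(1)},W^{(2)}$ independent Brownian motions. It is split into two subsystems: (I) $dX_t^{\mathrm I}=(r-\tfrac12(\sigma_t^{\mathrm I})^2)\,dt+\sqrt{1-\rho^2}\,\sigma_t^{\mathrm I}\,dW_t^{(1)}$, $\;d\sigma_t^{\mathrm I}=\kappa(\theta-\sigma_t^{\mathrm I})\,dt$; (II) $dX_t^{\mathrm{II}}=\rho\sigma_t^{\mathrm{II}}\,dW_t^{(2)}$, $\;d\sigma_t^{\mathrm{II}}=\xi\,dW_t^{(2)}$. For $v\in\mathbb{R}$ and $s>0$ define $$D(v,s)=\theta+(v-\theta)e^{-\kappa s},\qquad Q(v,s)=\int_0^s D(v,u)^2\,du=\theta^2 s+\frac{2\theta(v-\theta)}{\kappa}(1-e^{-\kappa s})+\frac{(v-\theta)^2}{2\kappa}(1-e^{-2\kappa s}).$$ Solving each subsystem exactly over a time interval of length $s$ from the state $(x,v)$ gives the following substep maps, where $\varepsilon$ denotes a standard normal variate: Suboperator I over length $s$: $\;\sigma^{\mathrm I}(v,s)=D(v,s)$, $\;X^{\mathrm I}(x,v,s)=x+rs-\tfrac12Q(v,s)+\sqrt{(1-\rho^2)Q(v,s)}\;\varepsilon$.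 Suboperator II over length $s$: $\;\sigma^{\mathrm{II}}(v,s)=v+\xi\sqrt s\,\varepsilon$, $\;X^{\mathrm{II}}(x,v,s)=x+\frac{\rho}{2\xi}\bigl[\sigma^{\mathrm{II}}(v,s)^2-v^2-\xi^2s\bigr]$ (the same $\varepsilon$ being used in $\sigma^{\mathrm{II}}$ and $X^{\mathrm{II}}$). One step of length $h$ of the Strang--Marchuk operator splitting scheme from $(X_t,\sigma_t)$ consists of a half step with suboperator I, a full step with suboperator II, and a half step with suboperator I: $$(\widetilde X,\widetilde\sigma)=\bigl(X^{\mathrm I}(X_t,\sigma_t,\tfrac h2),\,\sigma^{\mathrm I}(\sigma_t,\tfrac h2)\bigr),$$ $$(\widehat X,\widehat\sigma)=\bigl(X^{\mathrm{II}}(\widetilde X,\widetilde\sigma,h),\,\sigma^{\mathrm{II}}(\widetilde\sigma,h)\bigr),$$ $$(X_{t+h}^{\rm split},\sigma_{t+h}^{\rm split})=\bigl(X^{\mathrm I}(\widehat X,\widehat\sigma,\tfrac h2),\,\sigma^{\mathrm I}(\widehat\sigma,\tfrac h2)\bigr),$$ where the three substeps use three mutually independent standard normal variates, independent of $(X_t,\sigma_t)$. The variate $Z_2$ in the claim is the one used in the full step with suboperator II. *)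

theory Defs
  imports "HOL-Probability.Probability"
begin

definition sv_D :: "real \<Rightarrow> real \<Rightarrow> real \<Rightarrow> real \<Rightarrow> real" where
  "sv_D \<kappa> \<theta> v s = \<theta> + (v - \<theta>) * exp (- \<kappa> * s)"

definition sv_Q :: "real \<Rightarrow> real \<Rightarrow> real \<Rightarrow> real \<Rightarrow> real" where
  "sv_Q \<kappa> \<theta> v s = integral {0..s} (\<lambda>u. (sv_D \<kappa> \<theta> v u)\<^sup>2)"

lemma sv_Q_closed_form:
  assumes "\<kappa> > 0" "s > 0"
  shows "sv_Q \<kappa> \<theta> v s =
    \<theta>\<^sup>2 * s + 2 * \<theta> * (v - \<theta>) / \<kappa> * (1 - exp (- \<kappa> * s))
      + (v - \<theta>)\<^sup>2 / (2 * \<kappa>) * (1 - exp (- 2 * \<kappa> * s))"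
proof -
  define F where "F = (\<lambda>u. \<theta>\<^sup>2 * u + 2 * \<theta> * (v - \<theta>) / \<kappa> * (1 - exp (- \<kappa> * u))
      + (v - \<theta>)\<^sup>2 / (2 * \<kappa>) * (1 - exp (- 2 * \<kappa> * u)))"
  have sq: "exp (- 2 * \<kappa> * u) = exp (- \<kappa> * u) * exp (- \<kappa> * u)" for u
    by (simp flip: exp_add)
  have "(F has_real_derivative (sv_D \<kappa> \<theta> v u)\<^sup>2) (at u within {0..s})" for u
  proof -
    have "(F has_real_derivative (\<theta>\<^sup>2 + 2 * \<theta> * (v - \<theta>) / \<kappa> * (\<kappa> * exp (- \<kappa> * u))
        + (v - \<theta>)\<^sup>2 / (2 * \<kappa>) * (2 * \<kappa> * exp (- 2 * \<kappa> * u)))) (at u within {0..s})"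
      unfolding F_def by (rule derivative_eq_intros refl | simp)+
    moreover have "\<theta>\<^sup>2 + 2 * \<theta> * (v - \<theta>) / \<kappa> * (\<kappa> * exp (- \<kappa> * u))
        + (v - \<theta>)\<^sup>2 / (2 * \<kappa>) * (2 * \<kappa> * exp (- 2 * \<kappa> * u)) = (sv_D \<kappa> \<theta> v u)\<^sup>2"
      using assms unfolding sq sv_D_def by (simp add: power2_eq_square field_simps)
    ultimately show ?thesis by simp
  qed
  then have "((\<lambda>u. (sv_D \<kappa> \<theta> v u)\<^sup>2) has_integral F s - F 0) {0..s}"
    using assms by (intro fundamental_theorem_of_calculus)
      (auto simp flip: has_real_derivative_iff_has_vector_derivative)
  then show ?thesis
    unfolding sv_Q_def by (auto simp: F_def integral_unique)
qed

text \<open>Independence of two random variables whose value types may differ; the library's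
  \<open>indep_var\<close> forces both to have the same type.\<close>

definition (in prob_space) indep_rv ::
    "'b measure \<Rightarrow> ('a \<Rightarrow> 'b) \<Rightarrow> 'c measure \<Rightarrow> ('a \<Rightarrow> 'c) \<Rightarrow> bool" where
  "indep_rv S X T Y \<longleftrightarrow> X \<in> measurable M S \<and> Y \<in> measurable M T \<and>
     indep_set (sigma_sets (space M) {X -` A \<inter> space M | A. A \<in> sets S})
       (sigma_sets (space M) {Y -` A \<inter> space M | A. A \<in> sets T})"

lemma (in prob_space) indep_rv_iff_indep_var: "indep_rv S X T Y \<longleftrightarrow> indep_var S X T Y"
  by (simp add: indep_rv_def indep_var_eq)

text \<open>The substep maps act on states (log price, volatility); their last argument is the
  value of the normal variate driving the substep.\<close>

definition subop_I ::
    "real \<Rightarrow> real \<Rightarrow> real \<Rightarrow> real \<Rightarrow> real \<times> real \<Rightarrow> real \<Rightarrow> real \<Rightarrow> real \<times> real" where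
  "subop_I r \<kappa> \<theta> \<rho> = (\<lambda>(x, v) s \<epsilon>.
     (x + r * s - sv_Q \<kappa> \<theta> v s / 2 + sqrt ((1 - \<rho>\<^sup>2) * sv_Q \<kappa> \<theta> v s) * \<epsilon>,
      sv_D \<kappa> \<theta> v s))"

definition subop_II ::
    "real \<Rightarrow> real \<Rightarrow> real \<times> real \<Rightarrow> real \<Rightarrow> real \<Rightarrow> real \<times> real" where
  "subop_II \<xi> \<rho> = (\<lambda>(x, v) s \<epsilon>. let w = v + \<xi> * sqrt s * \<epsilon> in
     (x + \<rho> / (2 * \<xi>) * (w\<^sup>2 - v\<^sup>2 - \<xi>\<^sup>2 * s), w))"

definition strang_step ::
    "real \<Rightarrow> real \<Rightarrow> real \<Rightarrow> real \<Rightarrow> real \<Rightarrow> real \<Rightarrow> real \<times> real \<Rightarrow> real \<Rightarrow> real \<Rightarrow> real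
      \<Rightarrow> real \<times> real" where
  "strang_step r \<kappa> \<theta> \<xi> \<rho> h z \<epsilon>\<^sub>1 \<epsilon>\<^sub>2 \<epsilon>\<^sub>3 =
     subop_I r \<kappa> \<theta> \<rho> (subop_II \<xi> \<rho> (subop_I r \<kappa> \<theta> \<rho> z (h / 2) \<epsilon>\<^sub>1) h \<epsilon>\<^sub>2) (h / 2) \<epsilon>\<^sub>3"

end

theory Submission imports Defs begin

text \<open>Freeze the initial state and the variate \<open>\<epsilon> 2\<close> of the middle substep. The
  two variance terms \<open>Q\<^sub>1\<close>, \<open>Q\<^sub>3\<close> of the outer substeps are then constants, and
  \<open>sqrt Q\<^sub>1 * \<epsilon> 1 + sqrt Q\<^sub>3 * \<epsilon> 3\<close> is \<open>sqrt (Q\<^sub>1 + Q\<^sub>3)\<close> times a unit-norm combination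
  of independent standard normal variates. This combination \<open>Z\<^sub>1\<close> is standard normal
  whatever the frozen values are; a conditional law that does not depend on the condition
  is the unconditional law, and \<open>Z\<^sub>1\<close> is independent of the initial state and of \<open>\<epsilon> 2\<close>.\<close>

subsection \<open>Independence of random variables with different value types\<close>

text \<open>Preimages of measurable sets form an intersection-stable family, so the product rule on
  them extends to the generated sigma-algebras. Stated with \<open>emeasure\<close>, the rule
  applies directly to image and product measures.\<close>

lemma (in prob_space) indep_rv_iff_emeasure:
  "indep_rv S X T Y \<longleftrightarrow> X \<in> measurable M S \<and> Y \<in> measurable M T \<and>
    (\<forall>A\<in>sets S. \<forall>B\<in>sets T. emeasure M (X -` A \<inter> space M \<inter> (Y -` B \<inter> space M)) =
       emeasure M (X -` A \<inter> space M) * emeasure M (Y -` B \<inter> space M))"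
    (is "?L \<longleftrightarrow> ?X \<and> ?Y \<and> ?E")
proof -
  let ?P = "\<lambda>f N. {f -` A \<inter> space M | A. A \<in> sets N}"
  have stable: "Int_stable {f -` A \<inter> space M | A. A \<in> sets N}" for f :: "'a \<Rightarrow> 'x" and N
  proof (rule Int_stableI, clarify)
    fix A B assume "A \<in> sets N" "B \<in> sets N"
    then show "\<exists>C. f -` A \<inter> space M \<inter> (f -` B \<inter> space M) = f -` C \<inter> space M \<and> C \<in> sets N"
      by (intro exI[of _ "A \<inter> B"]) auto
  qed
  have "indep_set (sigma_sets (space M) (?P X S)) (sigma_sets (space M) (?P Y T)) \<longleftrightarrow> ?E"
    if X: ?X and Y: ?Y
  proof
    assume ind: "indep_set (sigma_sets (space M) (?P X S)) (sigma_sets (space M) (?P Y T))"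
    show ?E
    proof (intro ballI)
      fix A B assume "A \<in> sets S" "B \<in> sets T"
      then have "prob (X -` A \<inter> space M \<inter> (Y -` B \<inter> space M)) =
          prob (X -` A \<inter> space M) * prob (Y -` B \<inter> space M)"
        by (intro indep_setD[OF ind]) auto
      then show "emeasure M (X -` A \<inter> space M \<inter> (Y -` B \<inter> space M)) =
          emeasure M (X -` A \<inter> space M) * emeasure M (Y -` B \<inter> space M)"
        by (simp add: emeasure_eq_measure ennreal_mult)
    qed
  next
    assume E: ?E
    show "indep_set (sigma_sets (space M) (?P X S)) (sigma_sets (space M) (?P Y T))"
    proof (intro indep_set_sigma_sets stable indep_setI)
      show "?P X S \<subseteq> events" "?P Y T \<subseteq> events"
        using X Y by (auto intro: measurable_sets)
      show "prob (a \<inter> b) = prob a * prob b" if "a \<in> ?P X S" "b \<in> ?P Y T" for a b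
        using E that by (auto simp: emeasure_eq_measure simp flip: ennreal_mult)
    qed
  qed
  then show ?thesis
    by (auto simp: indep_rv_def)
qed

lemma (in prob_space) indep_rv_sym:
  "indep_rv S X T Y \<longleftrightarrow> indep_rv T Y S X"
  unfolding indep_rv_iff_emeasure by (metis Int_commute mult.commute)

lemma (in prob_space) indep_rv_compose:
  assumes ind: "indep_rv S X T Y" and f: "f \<in> measurable S S'" and g: "g \<in> measurable T T'"
  shows "indep_rv S' (\<lambda>\<omega>. f (X \<omega>)) T' (\<lambda>\<omega>. g (Y \<omega>))"
proof -
  have X: "X \<in> measurable M S" and Y: "Y \<in> measurable M T"
    using ind by (auto simp: indep_rv_def)
  have vimage: "(\<lambda>\<omega>. f (X \<omega>)) -` A \<inter> space M = X -` (f -` A \<inter> space S) \<inter> space M"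
    "(\<lambda>\<omega>. g (Y \<omega>)) -` B \<inter> space M = Y -` (g -` B \<inter> space T) \<inter> space M" for A B
    using measurable_space[OF X] measurable_space[OF Y] by auto
  show ?thesis
    using ind measurable_sets[OF f] measurable_sets[OF g]
      measurable_compose[OF X f] measurable_compose[OF Y g]
    unfolding indep_rv_iff_emeasure vimage by blast
qed

text \<open>Rectangles determine a product of sigma-finite measures, and on a rectangle the two
  sides agree by the product rule.\<close>

lemma (in prob_space) indep_rv_distr_pair:
  assumes "indep_rv S X T Y"
  shows "distr M (S \<Otimes>\<^sub>M T) (\<lambda>\<omega>. (X \<omega>, Y \<omega>)) = distr M S X \<Otimes>\<^sub>M distr M T Y"
proof -
  have [measurable]: "X \<in> measurable M S" "Y \<in> measurable M T"
    using assms by (auto simp: indep_rv_def)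
  interpret X: prob_space "distr M S X" by (rule prob_space_distr) simp
  interpret Y: prob_space "distr M T Y" by (rule prob_space_distr) simp
  show ?thesis
  proof (rule pair_measure_eqI[symmetric])
    fix A B assume "A \<in> sets (distr M S X)" "B \<in> sets (distr M T Y)"
    moreover from this have "(\<lambda>\<omega>. (X \<omega>, Y \<omega>)) -` (A \<times> B) \<inter> space M =
        X -` A \<inter> space M \<inter> (Y -` B \<inter> space M)" by auto
    ultimately show "emeasure (distr M S X) A * emeasure (distr M T Y) B =
        emeasure (distr M (S \<Otimes>\<^sub>M T) (\<lambda>\<omega>. (X \<omega>, Y \<omega>))) (A \<times> B)"
      using assms by (simp add: emeasure_distr indep_rv_iff_emeasure)
  qed (auto intro: X.sigma_finite_measure Y.sigma_finite_measure)
qed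

text \<open>By independence the joint law of \<open>W\<close> and \<open>V\<close> is a product, so
  the probability of \<open>W\<close> in \<open>A\<close> and \<open>f (W, V)\<close> in
  \<open>B\<close> is an integral of section measures. Every section over a point of
  \<open>A\<close> has measure \<open>N B\<close>, and all others are empty; the integral
  factors.\<close>

lemma (in prob_space) indep_rv_of_constant_fibre_law:
  assumes ind: "indep_rv S W T V" and f[measurable]: "f \<in> measurable (S \<Otimes>\<^sub>M T) U"
    and law: "\<And>w. w \<in> space S \<Longrightarrow> distr M U (\<lambda>\<omega>. f (w, V \<omega>)) = N"
  shows "indep_rv S W U (\<lambda>\<omega>. f (W \<omega>, V \<omega>))" and "distr M U (\<lambda>\<omega>. f (W \<omega>, V \<omega>)) = N"
proof -
  have [measurable]: "W \<in> measurable M S" "V \<in> measurable M T"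
    using ind by (auto simp: indep_rv_def)
  interpret V: prob_space "distr M T V" by (rule prob_space_distr) simp
  have space: "W \<omega> \<in> space S" "V \<omega> \<in> space T" if "\<omega> \<in> space M" for \<omega>
    using that by (auto intro: measurable_space[of _ M])
  \<comment> \<open>The assumption \<open>law\<close> reveals the sigma-algebra of \<open>N\<close>
    only at a point of \<open>space S\<close>; a probability space is nonempty, which supplies
    one.\<close>
  obtain \<omega>\<^sub>0 where "\<omega>\<^sub>0 \<in> space M" using not_empty by auto
  then have "W \<omega>\<^sub>0 \<in> space S" by (rule space)
  then have sets_N: "sets N = sets U" using law by (metis sets_distr)
  have joint: "emeasure M (W -` A \<inter> space M \<inter> ((\<lambda>\<omega>. f (W \<omega>, V \<omega>)) -` B \<inter> space M)) =
      emeasure M (W -` A \<inter> space M) * emeasure N B"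
    if [measurable]: "A \<in> sets S" "B \<in> sets U" for A B
  proof -
    let ?C = "{p \<in> space (S \<Otimes>\<^sub>M T). fst p \<in> A \<and> f p \<in> B}"
    have "W -` A \<inter> space M \<inter> ((\<lambda>\<omega>. f (W \<omega>, V \<omega>)) -` B \<inter> space M) =
        (\<lambda>\<omega>. (W \<omega>, V \<omega>)) -` ?C \<inter> space M"
      by (auto simp: space_pair_measure space)
    then have "emeasure M (W -` A \<inter> space M \<inter> ((\<lambda>\<omega>. f (W \<omega>, V \<omega>)) -` B \<inter> space M)) =
        emeasure (distr M S W \<Otimes>\<^sub>M distr M T V) ?C"
      by (simp add: emeasure_distr flip: indep_rv_distr_pair[OF ind])
    also have "\<dots> = (\<integral>\<^sup>+w. emeasure (distr M T V) (Pair w -` ?C) \<partial>distr M S W)"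
      by (rule V.emeasure_pair_measure_alt) simp
    also have "\<dots> = (\<integral>\<^sup>+w. emeasure N B * indicator A w \<partial>distr M S W)"
    proof (rule nn_integral_cong)
      fix w assume "w \<in> space (distr M S W)"
      then have [simp]: "w \<in> space S" by simp
      have sec: "Pair w -` ?C \<in> sets T" by (rule sets_Pair1[of _ S]) simp
      have "emeasure (distr M T V) (Pair w -` ?C) = emeasure M (V -` (Pair w -` ?C) \<inter> space M)"
        using sec by (simp add: emeasure_distr)
      also have "V -` (Pair w -` ?C) \<inter> space M =
          (if w \<in> A then (\<lambda>\<omega>. f (w, V \<omega>)) -` B \<inter> space M else {})"
        by (auto simp: space_pair_measure space)
      also have "emeasure M \<dots> = emeasure N B * indicator A w"
        by (simp add: emeasure_distr flip: law[of w])
      finally show "emeasure (distr M T V) (Pair w -` ?C) = emeasure N B * indicator A w" .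
    qed
    also have "\<dots> = emeasure M (W -` A \<inter> space M) * emeasure N B"
      by (subst nn_integral_cmult_indicator) (simp_all add: emeasure_distr mult.commute)
    finally show ?thesis .
  qed
  have marginal: "emeasure M ((\<lambda>\<omega>. f (W \<omega>, V \<omega>)) -` B \<inter> space M) = emeasure N B"
    if "B \<in> sets U" for B
  proof -
    \<comment> \<open>With \<open>A = space S\<close>, the joint formula becomes the law of
      \<open>f (W, V)\<close>; inserting this back into \<open>joint\<close> gives the product
      rule.\<close>
    have "W -` space S \<inter> space M = space M"
      by (auto simp: space)
    then show ?thesis
      using joint[OF sets.top that] by (simp add: emeasure_space_1 Int_absorb1)
  qed
  show "indep_rv S W U (\<lambda>\<omega>. f (W \<omega>, V \<omega>))"
    by (simp add: indep_rv_iff_emeasure joint marginal)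
  show "distr M U (\<lambda>\<omega>. f (W \<omega>, V \<omega>)) = N"
    by (rule measure_eqI) (simp_all add: sets_N emeasure_distr marginal)
qed

subsection \<open>Unit-norm combinations of independent standard normal variates\<close>

lemma distributed_std_normal_iff:
  "distributed M lborel X std_normal_density \<longleftrightarrow>
    X \<in> borel_measurable M \<and> distr M borel X = density lborel std_normal_density"
proof -
  have "distr M lborel X = distr M borel X" by (rule distr_cong) simp_all
  then show ?thesis by (auto simp: distributed_def)
qed

text \<open>A sum of independent centred normal variates is normal, and here the variances
  \<open>a\<^sup>2\<close> and \<open>b\<^sup>2\<close> add up to 1.\<close>

lemma (in prob_space) unit_combination_std_normal:
  fixes a b :: real
  assumes ind: "indep_var borel X borel Y"
    and X: "distributed M lborel X std_normal_density"
    and Y: "distributed M lborel Y std_normal_density"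
    and unit: "a\<^sup>2 + b\<^sup>2 = 1"
  shows "distributed M lborel (\<lambda>\<omega>. a * X \<omega> + b * Y \<omega>) std_normal_density"
proof -
  have scale: "distributed M lborel (\<lambda>\<omega>. c * Z \<omega>) (normal_density 0 \<bar>c\<bar>)"
    if "distributed M lborel Z std_normal_density" "c \<noteq> 0" for Z and c :: real
    using normal_density_affine[OF that(1) _ that(2), of 0] by simp
  \<comment> \<open>A zero coefficient produces a point mass, which has no density, so
    \<open>scale\<close> excludes it. The other coefficient then has absolute value 1, and symmetry
    of the normal law absorbs its sign.\<close>
  consider "a = 0" "\<bar>b\<bar> = 1" | "b = 0" "\<bar>a\<bar> = 1" | "a \<noteq> 0" "b \<noteq> 0"
    using unit by (cases "a = 0"; cases "b = 0") (auto simp: power2_eq_1_iff abs_if)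
  then show ?thesis
  proof cases
    case 1
    then show ?thesis using scale[OF Y, of b] by fastforce
  next
    case 2
    then show ?thesis using scale[OF X, of a] by fastforce
  next
    case 3
    have "indep_var borel ((*) a \<circ> X) borel ((*) b \<circ> Y)"
      by (rule indep_var_compose[OF ind]) auto
    from add_indep_normal[OF this[unfolded comp_def] _ _ scale[OF X] scale[OF Y]] 3 unit
    show ?thesis by simp
  qed
qed

text \<open>The constant-fibre lemma is used twice: for a fixed state it removes the dependence on
  \<open>\<epsilon> 2\<close>, then it removes the dependence on the state. The second use carries
  the pair of \<open>Z\<close> and \<open>\<epsilon> 2\<close>, because independence of
  \<open>Y\<close> from each of them separately would not give independence from the pair.\<close>

lemma (in prob_space) random_unit_combination_std_normal:
  fixes \<epsilon> :: "nat \<Rightarrow> 'a \<Rightarrow> real" and \<alpha> \<beta> :: "'b \<times> real \<Rightarrow> real"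
  assumes normal: "\<And>i. i \<in> {1, 2, 3} \<Longrightarrow> distributed M lborel (\<epsilon> i) std_normal_density"
    and indep: "indep_vars (\<lambda>_. borel) \<epsilon> {1, 2, 3}"
    and indep_Y: "indep_rv S Y borel (\<lambda>\<omega>. (\<epsilon> 1 \<omega>, \<epsilon> 2 \<omega>, \<epsilon> 3 \<omega>))"
    and [measurable]: "\<alpha> \<in> borel_measurable (S \<Otimes>\<^sub>M borel)" "\<beta> \<in> borel_measurable (S \<Otimes>\<^sub>M borel)"
    and unit: "\<And>p. (\<alpha> p)\<^sup>2 + (\<beta> p)\<^sup>2 = 1"
  defines "Z \<equiv> \<lambda>\<omega>. \<alpha> (Y \<omega>, \<epsilon> 2 \<omega>) * \<epsilon> 1 \<omega> + \<beta> (Y \<omega>, \<epsilon> 2 \<omega>) * \<epsilon> 3 \<omega>"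
  shows "distributed M lborel Z std_normal_density"
    and "indep_var borel Z borel (\<epsilon> 2)"
    and "indep_rv S Y borel (\<lambda>\<omega>. (Z \<omega>, \<epsilon> 2 \<omega>))"
proof -
  \<comment> \<open>Keeps the index 1 from being rewritten to \<open>Suc 0\<close>, so that facts
    about \<open>\<epsilon> 1\<close> keep their form.\<close>
  note One_nat_def[simp del]
  have [measurable]: "\<epsilon> 1 \<in> borel_measurable M" "\<epsilon> 2 \<in> borel_measurable M"
    "\<epsilon> 3 \<in> borel_measurable M" and [measurable]: "Y \<in> measurable M S"
    using normal indep_Y by (auto simp: distributed_std_normal_iff indep_rv_def)
  have pair: "indep_var borel (\<epsilon> i) borel (\<epsilon> j)" if "i \<in> {1, 2, 3}" "j \<in> {1, 2, 3}" "i \<noteq> j" for i j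
    using indep_var_compose[OF indep_var_restrict[OF indep, of "{i}" "{j}"],
        of "\<lambda>x. x i" borel "\<lambda>x. x j" borel] that
    by (simp add: comp_def)
  have indep_13: "indep_var borel (\<epsilon> 1) borel (\<epsilon> 3)" and indep_12: "indep_var borel (\<epsilon> 1) borel (\<epsilon> 2)"
    by (simp_all add: pair)
  have law_1: "distr M borel (\<epsilon> 1) = density lborel std_normal_density"
    using normal[of 1] by (simp add: distributed_std_normal_iff)

  have "indep_rv (PiM {2} (\<lambda>_. borel)) (\<lambda>\<omega>. restrict (\<lambda>i. \<epsilon> i \<omega>) {2})
      (PiM {1, 3} (\<lambda>_. borel)) (\<lambda>\<omega>. restrict (\<lambda>i. \<epsilon> i \<omega>) {1, 3})"
    unfolding indep_rv_iff_indep_var by (rule indep_var_restrict[OF indep]) auto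
  from indep_rv_compose[OF this, of "\<lambda>x. x 2" borel "\<lambda>x. (x 1, x 3)" "borel \<Otimes>\<^sub>M borel"]
  have indep_2_13: "indep_rv borel (\<epsilon> 2) (borel \<Otimes>\<^sub>M borel) (\<lambda>\<omega>. (\<epsilon> 1 \<omega>, \<epsilon> 3 \<omega>))"
    by simp

  \<comment> \<open>The law of \<open>(\<epsilon> 1, \<epsilon> 2)\<close> serves as the common
    fibre law: it does not mention \<open>y\<close>.\<close>
  have fibre: "distr M borel (\<lambda>\<omega>. (\<alpha> (y, \<epsilon> 2 \<omega>) * \<epsilon> 1 \<omega> + \<beta> (y, \<epsilon> 2 \<omega>) * \<epsilon> 3 \<omega>, \<epsilon> 2 \<omega>)) =
      distr M borel (\<lambda>\<omega>. (\<epsilon> 1 \<omega>, \<epsilon> 2 \<omega>))" if [measurable]: "y \<in> space S" for y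
  proof -
    let ?f = "\<lambda>p. \<alpha> (y, fst p) * fst (snd p) + \<beta> (y, fst p) * snd (snd p)"
    \<comment> \<open>With \<open>e\<close> in place of \<open>\<epsilon> 2 \<omega>\<close> the
      coefficients are constants, and the previous lemma applies.\<close>
    have "distr M borel (\<lambda>\<omega>. ?f (e, \<epsilon> 1 \<omega>, \<epsilon> 3 \<omega>)) = density lborel std_normal_density" for e
      using unit_combination_std_normal[OF indep_13 normal normal unit, of "(y, e)"]
      by (simp add: distributed_std_normal_iff)
    then have "indep_rv borel (\<epsilon> 2) borel (\<lambda>\<omega>. ?f (\<epsilon> 2 \<omega>, \<epsilon> 1 \<omega>, \<epsilon> 3 \<omega>))"
      and "distr M borel (\<lambda>\<omega>. ?f (\<epsilon> 2 \<omega>, \<epsilon> 1 \<omega>, \<epsilon> 3 \<omega>)) = density lborel std_normal_density"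
      by (intro indep_rv_of_constant_fibre_law[OF indep_2_13, where f = ?f]; simp)+
    \<comment> \<open>Both joint laws are products with the same factors, the standard normal law
      and the law of \<open>\<epsilon> 2\<close>. Symmetry is needed since the constant-fibre lemma
      puts \<open>\<epsilon> 2\<close> first.\<close>
    then show ?thesis
      using indep_rv_distr_pair[of borel "\<lambda>\<omega>. ?f (\<epsilon> 2 \<omega>, \<epsilon> 1 \<omega>, \<epsilon> 3 \<omega>)" borel "\<epsilon> 2"]
        indep_rv_distr_pair[of borel "\<epsilon> 1" borel "\<epsilon> 2"] indep_12
        indep_rv_sym[of borel "\<epsilon> 2" borel "\<lambda>\<omega>. ?f (\<epsilon> 2 \<omega>, \<epsilon> 1 \<omega>, \<epsilon> 3 \<omega>)"]
      by (simp add: indep_rv_iff_indep_var law_1 borel_prod)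
  qed
  \<comment> \<open>The argument is \<open>(y, e1, e2, e3)\<close>; the value pairs the combination
    of \<open>e1\<close> and \<open>e3\<close> with \<open>e2\<close>.\<close>
  let ?g = "\<lambda>p. (\<alpha> (fst p, fst (snd (snd p))) * fst (snd p) +
      \<beta> (fst p, fst (snd (snd p))) * snd (snd (snd p)), fst (snd (snd p)))"
  have [measurable]: "?g \<in> measurable (S \<Otimes>\<^sub>M borel) borel"
    by (simp add: borel_prod[symmetric])
  have law: "distr M borel (\<lambda>\<omega>. (Z \<omega>, \<epsilon> 2 \<omega>)) = distr M borel (\<lambda>\<omega>. (\<epsilon> 1 \<omega>, \<epsilon> 2 \<omega>))"
    using indep_rv_of_constant_fibre_law(2)[OF indep_Y, where f = ?g] fibre
    by (simp add: Z_def)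
  show "indep_rv S Y borel (\<lambda>\<omega>. (Z \<omega>, \<epsilon> 2 \<omega>))"
    using indep_rv_of_constant_fibre_law(1)[OF indep_Y, where f = ?g] fibre
    by (simp add: Z_def)
  have [measurable]: "Z \<in> borel_measurable M"
    unfolding Z_def by measurable
  have "distr M borel Z = distr (distr M borel (\<lambda>\<omega>. (Z \<omega>, \<epsilon> 2 \<omega>))) borel fst"
    by (simp add: distr_distr comp_def borel_prod[symmetric])
  also have "\<dots> = distr M borel (\<epsilon> 1)"
    unfolding law by (simp add: distr_distr comp_def borel_prod[symmetric])
  finally have law_Z: "distr M borel Z = distr M borel (\<epsilon> 1)" .
  then show "distributed M lborel Z std_normal_density"
    by (simp add: distributed_std_normal_iff law_1)
  \<comment> \<open>Independence depends only on the joint law and its marginals, which are those of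
    \<open>\<epsilon> 1\<close> and \<open>\<epsilon> 2\<close>.\<close>
  show "indep_var borel Z borel (\<epsilon> 2)"
    using indep_12 law by (simp add: indep_var_distribution_eq law_Z borel_prod)
qed

subsection \<open>The splitting step\<close>

lemma sv_Q_nonneg: "sv_Q \<kappa> \<theta> v s \<ge> 0"
  unfolding sv_Q_def sv_D_def
  by (intro integral_nonneg integrable_continuous_interval continuous_intros) auto

text \<open>The closed form is a polynomial in \<open>v\<close>, hence measurable.\<close>

lemma borel_measurable_sv_Q[measurable]:
  assumes "\<kappa> > 0" "s > 0"
  shows "(\<lambda>v. sv_Q \<kappa> \<theta> v s) \<in> borel_measurable borel"
  by (simp add: sv_Q_closed_form[OF assms])

theorem proposition1:
  fixes M :: "'a measure"
    and r \<kappa> \<theta> \<xi> \<rho> h :: real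
    and X \<sigma> X_split \<sigma>_split \<sigma>_tilde \<sigma>_hat I_split :: "'a \<Rightarrow> real"
    and \<epsilon> :: "nat \<Rightarrow> 'a \<Rightarrow> real"
  assumes "prob_space M"
    and "\<kappa> > 0" and "\<xi> > 0" and "\<rho> \<in> {-1..1}" and "h > 0"
    and "X \<in> borel_measurable M" and "\<sigma> \<in> borel_measurable M"
    and "\<And>i. i \<in> {1, 2, 3} \<Longrightarrow> distributed M lborel (\<epsilon> i) std_normal_density"
    and "prob_space.indep_vars M (\<lambda>_. borel) \<epsilon> {1, 2, 3}"
    and "prob_space.indep_rv M borel (\<lambda>\<omega>. (X \<omega>, \<sigma> \<omega>)) borel (\<lambda>\<omega>. (\<epsilon> 1 \<omega>, \<epsilon> 2 \<omega>, \<epsilon> 3 \<omega>))"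
    and "\<And>\<omega>. (X_split \<omega>, \<sigma>_split \<omega>)
           = strang_step r \<kappa> \<theta> \<xi> \<rho> h (X \<omega>, \<sigma> \<omega>) (\<epsilon> 1 \<omega>) (\<epsilon> 2 \<omega>) (\<epsilon> 3 \<omega>)"
    and "\<And>\<omega>. \<sigma>_tilde \<omega> = sv_D \<kappa> \<theta> (\<sigma> \<omega>) (h / 2)"
    and "\<And>\<omega>. \<sigma>_hat \<omega> = \<sigma>_tilde \<omega> + \<xi> * sqrt h * \<epsilon> 2 \<omega>"
    and "\<And>\<omega>. I_split \<omega> = sv_Q \<kappa> \<theta> (\<sigma> \<omega>) (h / 2) + sv_Q \<kappa> \<theta> (\<sigma>_hat \<omega>) (h / 2)"
  shows "\<exists>Z\<^sub>1 Z\<^sub>2. Z\<^sub>2 = \<epsilon> 2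
    \<and> distributed M lborel Z\<^sub>1 std_normal_density
    \<and> distributed M lborel Z\<^sub>2 std_normal_density
    \<and> prob_space.indep_var M borel Z\<^sub>1 borel Z\<^sub>2
    \<and> prob_space.indep_var M borel (\<lambda>\<omega>. (X \<omega>, \<sigma> \<omega>)) borel (\<lambda>\<omega>. (Z\<^sub>1 \<omega>, Z\<^sub>2 \<omega>))
    \<and> (\<forall>\<omega>\<in>space M.
          X_split \<omega> = X \<omega> + r * h - I_split \<omega> / 2
            + \<rho> / (2 * \<xi>) * ((\<sigma>_hat \<omega>)\<^sup>2 - (\<sigma>_tilde \<omega>)\<^sup>2 - \<xi>\<^sup>2 * h)
            + sqrt ((1 - \<rho>\<^sup>2) * I_split \<omega>) * Z\<^sub>1 \<omega>
        \<and> \<sigma>_split \<omega> = sv_D \<kappa> \<theta> (\<sigma>_hat \<omega>) (h / 2))"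
proof -
  interpret prob_space M by fact
  note Q_measurable[measurable] = borel_measurable_sv_Q[OF \<open>\<kappa> > 0\<close> half_gt_zero[OF \<open>h > 0\<close>]]
  \<comment> \<open>The variances of the outer substeps, before the factor
    \<open>1 - \<rho>\<^sup>2\<close>, as functions of \<open>p = ((x, v), e)\<close>: initial state
    and middle variate. In \<open>q\<^sub>3\<close> the volatility after the middle substep is
    expressed through \<open>v\<close> and \<open>e\<close>.\<close>
  define q\<^sub>1 where "q\<^sub>1 p = sv_Q \<kappa> \<theta> (snd (fst p)) (h / 2)" for p :: "(real \<times> real) \<times> real"
  define q\<^sub>3 where "q\<^sub>3 p = sv_Q \<kappa> \<theta> (sv_D \<kappa> \<theta> (snd (fst p)) (h / 2) + \<xi> * sqrt h * snd p) (h / 2)"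
    for p :: "(real \<times> real) \<times> real"
  \<comment> \<open>When both variances vanish, as for \<open>\<theta> = 0\<close>,
    \<open>v = 0\<close>, \<open>e = 0\<close>, the quotients would all be 0 and the unit norm would
    fail. The default weights 1 and 0 restore it, and \<open>combine\<close> then reads
    \<open>0 = 0\<close>.\<close>
  define \<alpha> where "\<alpha> p = (if q\<^sub>1 p + q\<^sub>3 p = 0 then 1 else sqrt (q\<^sub>1 p / (q\<^sub>1 p + q\<^sub>3 p)))" for p
  define \<beta> where "\<beta> p = (if q\<^sub>1 p + q\<^sub>3 p = 0 then 0 else sqrt (q\<^sub>3 p / (q\<^sub>1 p + q\<^sub>3 p)))" for p
  have q_nonneg[simp]: "q\<^sub>1 p \<ge> 0" "q\<^sub>3 p \<ge> 0" for p
    by (simp_all add: q\<^sub>1_def q\<^sub>3_def sv_Q_nonneg)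
  have [measurable]: "q\<^sub>1 \<in> borel_measurable (borel \<Otimes>\<^sub>M borel)" "q\<^sub>3 \<in> borel_measurable (borel \<Otimes>\<^sub>M borel)"
    unfolding q\<^sub>1_def[abs_def] q\<^sub>3_def[abs_def] sv_D_def borel_prod[symmetric] by measurable
  have \<alpha>\<beta>_measurable: "\<alpha> \<in> borel_measurable (borel \<Otimes>\<^sub>M borel)" "\<beta> \<in> borel_measurable (borel \<Otimes>\<^sub>M borel)"
    unfolding \<alpha>_def[abs_def] \<beta>_def[abs_def] by measurable
  have unit: "(\<alpha> p)\<^sup>2 + (\<beta> p)\<^sup>2 = 1" for p
    by (auto simp: \<alpha>_def \<beta>_def simp flip: add_divide_distrib)
  have combine: "sqrt (c * q\<^sub>1 p) * x + sqrt (c * q\<^sub>3 p) * y =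
      sqrt (c * (q\<^sub>1 p + q\<^sub>3 p)) * (\<alpha> p * x + \<beta> p * y)" for c p x y
  proof (cases "q\<^sub>1 p + q\<^sub>3 p = 0")
    case True
    then have "q\<^sub>1 p = 0" "q\<^sub>3 p = 0" using q_nonneg[of p] by linarith+
    then show ?thesis by simp
  next
    case False
    then show ?thesis
      unfolding real_sqrt_mult \<alpha>_def \<beta>_def by (simp add: real_sqrt_divide field_simps)
  qed
  let ?Z = "\<lambda>\<omega>. \<alpha> ((X \<omega>, \<sigma> \<omega>), \<epsilon> 2 \<omega>) * \<epsilon> 1 \<omega> + \<beta> ((X \<omega>, \<sigma> \<omega>), \<epsilon> 2 \<omega>) * \<epsilon> 3 \<omega>"
  note law = random_unit_combination_std_normal[OF assms(8-10) \<alpha>\<beta>_measurable unit]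
  have "X_split \<omega> = X \<omega> + r * h - I_split \<omega> / 2
            + \<rho> / (2 * \<xi>) * ((\<sigma>_hat \<omega>)\<^sup>2 - (\<sigma>_tilde \<omega>)\<^sup>2 - \<xi>\<^sup>2 * h)
            + sqrt ((1 - \<rho>\<^sup>2) * I_split \<omega>) * ?Z \<omega>
        \<and> \<sigma>_split \<omega> = sv_D \<kappa> \<theta> (\<sigma>_hat \<omega>) (h / 2)" for \<omega>
  proof -
    let ?p = "((X \<omega>, \<sigma> \<omega>), \<epsilon> 2 \<omega>)"
    have hat: "sv_D \<kappa> \<theta> (\<sigma> \<omega>) (h / 2) + \<xi> * sqrt h * \<epsilon> 2 \<omega> = \<sigma>_hat \<omega>"
      by (simp add: assms(12,13))
    have I: "I_split \<omega> = q\<^sub>1 ?p + q\<^sub>3 ?p"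
      by (simp add: assms(14) q\<^sub>1_def q\<^sub>3_def hat)
    have "(X_split \<omega>, \<sigma>_split \<omega>) =
        (X \<omega> + r * (h / 2) - q\<^sub>1 ?p / 2 + sqrt ((1 - \<rho>\<^sup>2) * q\<^sub>1 ?p) * \<epsilon> 1 \<omega>
          + \<rho> / (2 * \<xi>) * ((\<sigma>_hat \<omega>)\<^sup>2 - (\<sigma>_tilde \<omega>)\<^sup>2 - \<xi>\<^sup>2 * h)
          + r * (h / 2) - q\<^sub>3 ?p / 2 + sqrt ((1 - \<rho>\<^sup>2) * q\<^sub>3 ?p) * \<epsilon> 3 \<omega>,
         sv_D \<kappa> \<theta> (\<sigma>_hat \<omega>) (h / 2))"
      unfolding assms(11) strang_step_def subop_I_def subop_II_def
      by (simp add: Let_def hat q\<^sub>1_def q\<^sub>3_def assms(12))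
    then show ?thesis
      using combine[of "1 - \<rho>\<^sup>2" ?p "\<epsilon> 1 \<omega>" "\<epsilon> 3 \<omega>"] unfolding I
      by (simp add: add_divide_distrib)
  qed
  then show ?thesis
    \<comment> \<open>Both the state and the pair of variates have values in
      \<open>real \<times> real\<close>, so the \<open>indep_rv\<close> fact from \<open>law\<close>
      is an \<open>indep_var\<close> statement.\<close>
    using law assms(8)[of 2]
    by (intro exI[of _ ?Z] exI[of _ "\<epsilon> 2"]) (simp add: indep_rv_iff_indep_var)
qed

end
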